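(* Let $\ell:\mathbb{R}^2\to[0,\infty)$ be a function that is continuously differentiable on $\mathbb{R}^2\setminus\{(0,0)\}$ and satisfies, for every $(x,y)\neq(0,0)$, $$(x,y)=\ell(x,y)\,\nabla\ell(x,y),\qquad \ell\big(\nabla\ell(x,y)\big)=1,$$ where $\nabla\ell=\left(\frac{\partial \ell}{\partial x},\frac{\partial\ell}{\partial y}\right)$. Then $\ell(x,y)=\sqrt{x^2+y^2}$ for all $(x,y)\neq(0,0)$. Conversely, the function $\sqrt{x^2+y^2}$ is continuously differentiable away from the origin and satisfies both equations at every $(x,y)\neq(0,0)$.
   Context: Coordinates are with respect to the standard basis of $\mathbb{R}^2$; $\ell(x,y)\,\nabla\ell(x,y)$ denotes multiplication of a vector by a scalar, and $\ell(\nabla\ell(x,y))$ denotes $\ell$ evaluated at the vector $\nabla\ell(x,y)$. *)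

theory Defs
  imports "HOL-Analysis.Analysis"
begin

definition gradient :: "(real \<times> real \<Rightarrow> real) \<Rightarrow> real \<times> real \<Rightarrow> real \<times> real" where
  "gradient f = (\<lambda>(x, y). (deriv (\<lambda>t. f (t, y)) x, deriv (\<lambda>t. f (x, t)) y))"

(* Meant for open S: the derivative is the full Frechet derivative, and it is continuous
   on S with respect to the operator norm. *)
definition continuously_differentiable_on ::
    "('a::real_normed_vector \<Rightarrow> 'b::real_normed_vector) \<Rightarrow> 'a set \<Rightarrow> bool"
    (infix "continuously'_differentiable'_on" 50) where
  "f continuously_differentiable_on S \<longleftrightarrow>
     (\<exists>f' :: 'a \<Rightarrow> ('a \<Rightarrow>\<^sub>L 'b).
        (\<forall>p\<in>S. (f has_derivative blinfun_apply (f' p)) (at p)) \<and> continuous_on S f')"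

end

theory Submission imports Defs begin

text \<open>
  Write \<open>|p|\<close> for the Euclidean norm. The first equation says that \<open>l\<^sup>2\<close> and \<open>|p|\<^sup>2\<close> have the same
  gradient \<open>2p\<close> on the punctured plane, which is connected, so \<open>l\<^sup>2 = |p|\<^sup>2 + c\<close> there for some
  constant \<open>c\<close> (\<open>radial_up_to_constant\<close>). Everything else is deciding \<open>c\<close>: the first
  equation also gives \<open>\<nabla>l(p) = p / l(p)\<close>, so evaluating \<open>l\<^sup>2 = |p|\<^sup>2 + c\<close> at this vector, where \<open>l\<close>
  is 1, yields \<open>1 = |p|\<^sup>2 / l(p)\<^sup>2 + c\<close>. Eliminating \<open>l(p)\<close> leaves \<open>c |p|\<^sup>2 = c (1 - c)\<close> for all
  \<open>p \<noteq> 0\<close>; the left side takes different values at points of different norm unless \<open>c = 0\<close>, and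
  then \<open>l = |p|\<close> because \<open>l\<close> is nonnegative.

  Conversely, the norm has gradient \<open>p / |p|\<close>, a unit vector, away from the origin.
\<close>

text \<open>
  Partial derivatives alone do not control a function of two variables; Frechet differentiability
  is what makes them determine the derivative in every direction. Stated for arbitrary \<open>D\<close>, this
  serves both to differentiate \<open>l\<^sup>2\<close> and to read off the gradient of the norm.
\<close>
lemma has_derivative_imp_inner_gradient:
  assumes "(f has_derivative D) (at p)"
  shows "D h = h \<bullet> gradient f p"
proof -
  obtain x y where p: "p = (x, y)" by (cases p)
  obtain a b where h: "h = (a, b)" by (cases h)
  interpret D: bounded_linear D using assms by (rule has_derivative_bounded_linear)
  define A B where "A = D (1, 0)" and "B = D (0, 1)"
  have scale_fst: "D (t, 0) = A * t" for t
    using D.scaleR[of t "(1, 0)"] by (simp add: A_def)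
  have scale_snd: "D (0, t) = B * t" for t
    using D.scaleR[of t "(0, 1)"] by (simp add: B_def)
  have D: "(f has_derivative D) (at (x, y))"
    using assms p by simp
  have "((\<lambda>t. (t, y)) has_derivative (\<lambda>t. (t, 0))) (at x)"
    by (auto intro!: derivative_eq_intros)
  from has_derivative_compose[OF this D] have fst_partial: "deriv (\<lambda>t. f (t, y)) x = A"
    by (intro DERIV_imp_deriv) (simp add: has_field_derivative_def scale_fst)
  have "((\<lambda>t. (x, t)) has_derivative (\<lambda>t. (0, t))) (at y)"
    by (auto intro!: derivative_eq_intros)
  from has_derivative_compose[OF this D] have snd_partial: "deriv (\<lambda>t. f (x, t)) y = B"
    by (intro DERIV_imp_deriv) (simp add: has_field_derivative_def scale_snd)
  have "D h = D (a, 0) + D (0, b)"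
    using D.add[of "(a, 0)" "(0, b)"] h by simp
  then show ?thesis
    by (simp add: scale_fst scale_snd gradient_def p h fst_partial snd_partial)
qed

lemma gradient_norm:
  assumes "p \<noteq> 0"
  shows "gradient norm p = sgn p"
  using has_derivative_imp_inner_gradient[OF has_derivative_norm[OF assms]]
  by (metis vector_eq_ldot)

lemma norm_continuously_differentiable_on:
  "(norm :: 'a::real_inner \<Rightarrow> real) continuously_differentiable_on (UNIV - {0})"
  unfolding continuously_differentiable_on_def
proof (intro exI conjI ballI)
  fix p :: 'a assume "p \<in> UNIV - {0}"
  then show "(norm has_derivative blinfun_apply (blinfun_inner_left (sgn p))) (at p)"
    using has_derivative_norm[of p] by (simp add: blinfun_inner_left.rep_eq)
next
  show "continuous_on (UNIV - {0}) (\<lambda>p. blinfun_inner_left (sgn p) :: 'a \<Rightarrow>\<^sub>L real)"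
    by (intro bounded_linear.continuous_on[OF bounded_linear_blinfun_inner_left] continuous_intros) auto
qed

text \<open>
  The equation \<open>p = l(p) \<nabla>l(p)\<close> is half of \<open>\<nabla>(l\<^sup>2 - |p|\<^sup>2) = 0\<close>. Only a punctured plane, not a
  punctured line, is connected, so a single constant works for all \<open>p\<close>.
\<close>
lemma radial_up_to_constant:
  fixes l :: "real \<times> real \<Rightarrow> real"
  assumes diff: "\<And>p. p \<noteq> 0 \<Longrightarrow> l differentiable (at p)"
    and eq: "\<And>p. p \<noteq> 0 \<Longrightarrow> p = l p *\<^sub>R gradient l p"
  obtains c where "\<And>p. p \<noteq> 0 \<Longrightarrow> (l p)\<^sup>2 = (norm p)\<^sup>2 + c"
proof -
  define g where "g p = (l p)\<^sup>2 - p \<bullet> p" for p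
  have deriv_zero: "(g has_derivative (\<lambda>h. 0)) (at p)" if p: "p \<noteq> 0" for p
  proof -
    obtain D where D: "(l has_derivative D) (at p)"
      using diff[OF p] by (auto simp: differentiable_def)
    have "l p * D h = h \<bullet> p" for h
      using has_derivative_imp_inner_gradient[OF D, of h] eq[OF p]
      by (metis inner_scaleR_right)
    then have "2 * (l p * D h) - (p \<bullet> h + h \<bullet> p) = 0" for h
      by (simp add: inner_commute)
    then show ?thesis
      unfolding g_def
      by (auto intro!: derivative_eq_intros D simp: algebra_simps)
  qed
  have conn: "connected (- {0 :: real \<times> real})"
    by (rule connected_punctured_universe) simp
  define u :: "real \<times> real" where "u = (1, 0)"
  have "g p = g u" if "p \<noteq> 0" for p
    by (rule has_derivative_zero_unique_connected[OF _ conn])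
       (use that deriv_zero in \<open>auto simp: u_def zero_prod_def\<close>)
  then have "(l p)\<^sup>2 = (norm p)\<^sup>2 + g u" if "p \<noteq> 0" for p
    using that by (simp add: g_def power2_norm_eq_inner algebra_simps)
  then show thesis by (rule that)
qed

lemma normalized_radial_eq_norm:
  fixes l :: "real \<times> real \<Rightarrow> real"
  assumes nonneg: "\<And>p. 0 \<le> l p"
    and diff: "\<And>p. p \<noteq> 0 \<Longrightarrow> l differentiable (at p)"
    and eq: "\<And>p. p \<noteq> 0 \<Longrightarrow> p = l p *\<^sub>R gradient l p"
    and unit: "\<And>p. p \<noteq> 0 \<Longrightarrow> l (gradient l p) = 1"
    and "p \<noteq> 0"
  shows "l p = norm p"
proof -
  obtain c where c: "\<And>p. p \<noteq> 0 \<Longrightarrow> (l p)\<^sup>2 = (norm p)\<^sup>2 + c"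
    using radial_up_to_constant[OF diff eq] by blast
  have elim: "c * (norm q)\<^sup>2 = c * (1 - c)" if q: "q \<noteq> 0" for q :: "real \<times> real"
  proof -
    have "gradient l q \<noteq> 0"
      using eq[OF q] q by (metis scaleR_zero_right)
    then have n: "(norm (gradient l q))\<^sup>2 = 1 - c"
      using c[of "gradient l q"] unit[OF q] by simp
    have "(norm q)\<^sup>2 = (l q)\<^sup>2 * (norm (gradient l q))\<^sup>2"
      using eq[OF q] by (metis norm_scaleR power_mult_distrib power2_abs)
    also have "\<dots> = ((norm q)\<^sup>2 + c) * (1 - c)"
      using n c[OF q] by simp
    finally show ?thesis by (simp add: algebra_simps)
  qed
  \<comment> \<open>Two points whose squared norms, 1 and 4, differ.\<close>
  have "c * 1 = c * 4"
    using elim[of "(1, 0)"] elim[of "(2, 0)"] by (simp add: zero_prod_def norm_Pair)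
  then have "(l p)\<^sup>2 = (norm p)\<^sup>2"
    using c[OF \<open>p \<noteq> 0\<close>] by simp
  then show ?thesis
    using nonneg by (simp add: power2_eq_iff_nonneg)
qed

theorem mainTheorem1:
  "(\<forall>l :: real \<times> real \<Rightarrow> real.
      (\<forall>p. 0 \<le> l p) \<longrightarrow>
      l continuously_differentiable_on (UNIV - {(0, 0)}) \<longrightarrow>
      (\<forall>x y. (x, y) \<noteq> (0, 0) \<longrightarrow>
         (x, y) = l (x, y) *\<^sub>R gradient l (x, y) \<and> l (gradient l (x, y)) = 1) \<longrightarrow>
      (\<forall>x y. (x, y) \<noteq> (0, 0) \<longrightarrow> l (x, y) = sqrt (x\<^sup>2 + y\<^sup>2)))
   \<and>
   (let r = (\<lambda>(x, y). sqrt (x\<^sup>2 + y\<^sup>2)) :: real \<times> real \<Rightarrow> real in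
      r continuously_differentiable_on (UNIV - {(0, 0)}) \<and>
      (\<forall>x y. (x, y) \<noteq> (0, 0) \<longrightarrow>
         (x, y) = r (x, y) *\<^sub>R gradient r (x, y) \<and> r (gradient r (x, y)) = 1))"
proof (rule conjI)
  show "\<forall>l :: real \<times> real \<Rightarrow> real.
      (\<forall>p. 0 \<le> l p) \<longrightarrow>
      l continuously_differentiable_on (UNIV - {(0, 0)}) \<longrightarrow>
      (\<forall>x y. (x, y) \<noteq> (0, 0) \<longrightarrow>
         (x, y) = l (x, y) *\<^sub>R gradient l (x, y) \<and> l (gradient l (x, y)) = 1) \<longrightarrow>
      (\<forall>x y. (x, y) \<noteq> (0, 0) \<longrightarrow> l (x, y) = sqrt (x\<^sup>2 + y\<^sup>2))"
  proof (intro allI impI)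
    fix l :: "real \<times> real \<Rightarrow> real" and x y :: real
    assume nonneg: "\<forall>p. 0 \<le> l p"
      and c1: "l continuously_differentiable_on (UNIV - {(0, 0)})"
      and eqs: "\<forall>x y. (x, y) \<noteq> (0, 0) \<longrightarrow>
         (x, y) = l (x, y) *\<^sub>R gradient l (x, y) \<and> l (gradient l (x, y)) = 1"
      and "(x, y) \<noteq> (0, 0)"
    have "l differentiable (at p)" if "p \<noteq> 0" for p
      using c1 that
      by (auto simp: continuously_differentiable_on_def differentiable_def zero_prod_def)
    moreover have "p = l p *\<^sub>R gradient l p" "l (gradient l p) = 1" if "p \<noteq> 0" for p
      using eqs that by (metis surj_pair zero_prod_def)+
    ultimately have "l (x, y) = norm (x, y)"
      using nonneg \<open>(x, y) \<noteq> (0, 0)\<close>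
      by (intro normalized_radial_eq_norm) (auto simp: zero_prod_def)
    then show "l (x, y) = sqrt (x\<^sup>2 + y\<^sup>2)"
      by (simp add: norm_Pair)
  qed
next
  have r: "(\<lambda>(x, y). sqrt (x\<^sup>2 + y\<^sup>2)) = (norm :: real \<times> real \<Rightarrow> real)"
    by (auto simp: norm_Pair)
  have "p = norm p *\<^sub>R gradient norm p \<and> norm (gradient norm p) = 1"
    if "p \<noteq> 0" for p :: "real \<times> real"
    using that by (simp add: gradient_norm sgn_div_norm)
  then show "let r = (\<lambda>(x, y). sqrt (x\<^sup>2 + y\<^sup>2)) :: real \<times> real \<Rightarrow> real in
      r continuously_differentiable_on (UNIV - {(0, 0)}) \<and>
      (\<forall>x y. (x, y) \<noteq> (0, 0) \<longrightarrow>
         (x, y) = r (x, y) *\<^sub>R gradient r (x, y) \<and> r (gradient r (x, y)) = 1)"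
    using norm_continuously_differentiable_on[where ?'a = "real \<times> real"]
    unfolding r Let_def zero_prod_def by blast
qed

end
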